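(* Let $m\in\{1,2\}$. For every integer $\Delta\ge 1$, $$\mathfrak{c}(\Delta,m)=\frac{1}{2}(m^2+m)+m(\Delta-1).$$
   Context: A matrix is treated as the multiset of its columns. Two vectors $\mathbf{a},\overline{\mathbf{a}}\in\mathbb{R}^d$ differ if $\mathbf{a}\neq\pm\overline{\mathbf{a}}$. A multiset $X\subseteq\mathbb{R}^d$ has differing columns if every pair of vectors in $X$ differs and $\mathbf{0}\notin X$. The number of differing columns of a matrix $A$, i.e. the largest cardinality of a subset of the columns of $A$ that has differing columns, is denoted $|A|$. For an integer matrix $A$ with $m$ rows and $\operatorname{rank} A=m$, let $\Delta(A):=\max\{|\det B| : B \text{ is an } m\times m \text{ submatrix of } A\}$; $A$ is $\Delta$-modular if $\Delta(A)\le\Delta$. For integers $\Delta,m\ge 1$, $$\mathfrak{c}(\Delta,m):=\max\{|A| : A \text{ is an integer matrix with } m \text{ rows},\ \operatorname{rank}A=m,\ \Delta(A)\le\Delta\}.$$ *)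

theory Defs
  imports
    "HOL-Library.Multiset"
    "Jordan_Normal_Form.DL_Rank"
    "Jordan_Normal_Form.DL_Submatrix"
    "Jordan_Normal_Form.Determinant"
begin

definition differ :: "'a::ab_group_add vec \<Rightarrow> 'a vec \<Rightarrow> bool" where
  "differ a b \<longleftrightarrow> a \<noteq> b \<and> a \<noteq> - b"

text \<open>A pair of vectors in \<open>X\<close> is a two-element sub-multiset, so a vector
  of multiplicity at least two forms a pair with itself, and this pair does not differ.\<close>

definition differing_columns :: "'a::ab_group_add vec multiset \<Rightarrow> bool" where
  "differing_columns X \<longleftrightarrow>
     (\<forall>a b. {#a, b#} \<subseteq># X \<longrightarrow> differ a b) \<and> (\<forall>a \<in># X. a \<noteq> 0\<^sub>v (dim_vec a))"

definition num_differing_columns :: "'a::ab_group_add mat \<Rightarrow> nat" where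
  "num_differing_columns A = Max {size X | X. X \<subseteq># mset (cols A) \<and> differing_columns X}"

text \<open>Only meaningful if \<open>A\<close> has at least one square submatrix of full height, which
  holds whenever \<open>A\<close> has full row rank; otherwise the set below is empty.\<close>

definition max_minor :: "int mat \<Rightarrow> int" where
  "max_minor A = Max {\<bar>det (submatrix A {..<dim_row A} J)\<bar> | J.
                        J \<subseteq> {..<dim_col A} \<and> card J = dim_row A}"

definition full_row_rank :: "int mat \<Rightarrow> bool" where
  "full_row_rank A \<longleftrightarrow> vec_space.rank (dim_row A) (map_mat real_of_int A) = dim_row A"

definition modular :: "int \<Rightarrow> int mat \<Rightarrow> bool" where
  "modular \<Delta> A \<longleftrightarrow> full_row_rank A \<and> max_minor A \<le> \<Delta>"

text \<open>The number of columns of \<open>A\<close> is unrestricted.\<close>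

definition max_num_differing_columns :: "int \<Rightarrow> nat \<Rightarrow> nat" where
  "max_num_differing_columns \<Delta> m =
     Max {num_differing_columns A | A. dim_row A = m \<and> modular \<Delta> A}"

end

theory Submission
  imports
    Defs
    "HOL-Library.Product_Plus"
    "Jordan_Normal_Form.DL_Rank_Submatrix"
begin

text \<open>
  For \<open>m = 1\<close> the minors are the entries, and the nonzero integers of absolute value at most \<open>\<Delta>\<close> form \<open>\<Delta>\<close>
  pairs \<open>\<plusminus>x\<close>. For \<open>m = 2\<close> the claimed value is \<open>2 \<Delta> + 1\<close>. It is attained by the columns \<open>(i, 0)\<close> with
  \<open>1 \<le> i \<le> \<Delta>\<close> and \<open>(i, 1)\<close> with \<open>0 \<le> i \<le> \<Delta>\<close>.

  The upper bound for \<open>m = 2\<close> is a lattice point count, carried out in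
  \<open>card_no_opposite_le_pairwise_cross\<close>. Let \<open>C\<close> consist of the columns and their negatives, and choose
  \<open>a, b \<in> C\<close> such that \<open>det (a, b) = M\<close> is maximal; it is positive by full rank and at most \<open>\<Delta>\<close>. Write
  \<open>b = k b'\<close> with \<open>b'\<close> primitive, and \<open>n = det (a, b')\<close>, so that \<open>M = n k\<close>. Maximality of \<open>M\<close> places \<open>C\<close> in the
  parallelogram \<open>\<bar>det (x, b')\<bar> \<le> n\<close>, \<open>\<bar>det (a, x)\<bar> \<le> n k\<close>. Up to sign, the points of \<open>C\<close> lie on the lines
  \<open>det (x, b') = j\<close> with \<open>0 \<le> j \<le> n\<close>. Neighbouring lattice points on such a line differ by \<open>b'\<close>
  (\<open>cross_dvd_if_coprime\<close>), hence have values of \<open>det (a, x)\<close> that differ by \<open>n\<close>, and counting points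
  reduces to counting integers of one residue class in an interval (\<open>card_congruent_le\<close>). The line
  \<open>j = 0\<close> contributes at most \<open>k\<close> points up to sign and the line \<open>j = n\<close> at most \<open>k + 1\<close>, since there
  any two points have a determinant of at most \<open>M\<close>. A line in between has up to \<open>2 k + 1\<close> lattice points
  in the closed parallelogram. If \<open>b\<close> is chosen to be extreme on the edge \<open>det (a, x) = M\<close>, then these
  lines do not meet \<open>C\<close> on that edge, and each contributes at most \<open>2 k\<close>. The sum is
  \<open>k + 2 k (n - 1) + k + 1 = 2 M + 1\<close>.
\<close>

section \<open>Lattice points in the plane with bounded pairwise determinants\<close>

text \<open>The determinant of the \<open>2 \<times> 2\<close> matrix with columns \<open>x\<close> and \<open>y\<close>.\<close>

definition cross :: "int \<times> int \<Rightarrow> int \<times> int \<Rightarrow> int" where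
  "cross x y = fst x * snd y - snd x * fst y"

lemma cross_self [simp]: "cross x x = 0"
  by (simp add: cross_def)

lemma cross_swap: "cross y x = - cross x y"
  by (simp add: cross_def)

lemma cross_minus [simp]: "cross (- x) y = - cross x y" "cross x (- y) = - cross x y"
  by (simp_all add: cross_def)

lemma cross_pluecker:
  "cross a b * cross x y = cross a x * cross b y - cross a y * cross b x"
  by (simp add: cross_def algebra_simps)

text \<open>For independent \<open>a\<close> and \<open>b\<close> the numbers \<open>cross x b\<close> and \<open>cross a x\<close> are, up to the common factor
  \<open>cross a b\<close>, the coordinates of \<open>x\<close> in the basis \<open>a, b\<close> (Cramer's rule).\<close>

lemma eq_if_cross_eq:
  assumes "cross a b \<noteq> 0" "cross x b = cross y b" "cross a x = cross a y"
  shows "x = y"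
proof -
  define d where "d = x - y"
  have d: "cross d b = 0" "cross a d = 0"
    using assms by (simp_all add: d_def cross_def algebra_simps)
  \<comment> \<open>Cramer's rule for the difference vector\<close>
  have "cross a b * fst d = fst b * cross a d + fst a * cross d b"
    "cross a b * snd d = snd b * cross a d + snd a * cross d b"
    by (simp_all add: cross_def algebra_simps)
  then have "fst d = 0" "snd d = 0"
    using d assms(1) by simp_all
  then show "x = y"
    by (simp add: d_def prod_eq_iff)
qed

text \<open>On a line parallel to a primitive vector \<open>b\<close>, consecutive lattice points differ by exactly \<open>b\<close>,
  so \<open>cross a\<close> moves along it in steps of \<open>cross a b\<close>.\<close>

lemma cross_dvd_if_coprime:
  assumes "coprime (fst b) (snd b)" "cross x b = cross y b"
  shows "cross a b dvd cross a x - cross a y"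
proof -
  obtain u v where uv: "u * fst b + v * snd b = 1"
    using bezout_int[of "fst b" "snd b"] assms(1) by auto
  define d where "d = x - y"
  have d0: "cross d b = 0"
    using assms(2) by (simp add: d_def cross_def algebra_simps)
  \<comment> \<open>The multiplier with \<open>d = t b\<close>, extracted from \<open>d\<close> by the Bezout coefficients of \<open>b\<close>\<close>
  define t where "t = u * fst d + v * snd d"
  have "t * fst b = fst d * (u * fst b + v * snd b) - v * cross d b"
    "t * snd b = snd d * (u * fst b + v * snd b) + u * cross d b"
    by (simp_all add: t_def cross_def algebra_simps)
  then have "fst d = t * fst b" "snd d = t * snd b"
    using uv d0 by simp_all
  then have "cross a d = t * cross a b"
    by (simp add: cross_def algebra_simps)
  then have "cross a x - cross a y = cross a b * t"
    by (simp add: d_def cross_def algebra_simps)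
  then show ?thesis
    by simp
qed

lemma card_congruent_le:
  fixes F :: "int set"
  assumes "n > 0" "k \<ge> 0" and F: "F \<subseteq> {l..<l + n * k}"
    and cong: "\<And>z w. z \<in> F \<Longrightarrow> w \<in> F \<Longrightarrow> n dvd z - w"
  shows "int (card F) \<le> k"
proof -
  let ?q = "\<lambda>z. (z - l) div n"
  have "inj_on ?q F"
  proof (rule inj_onI)
    fix z w assume zw: "z \<in> F" "w \<in> F" "?q z = ?q w"
    have "(z - l) mod n = (w - l) mod n"
      using cong[OF zw(1,2)] by (simp add: mod_eq_dvd_iff)
    then have "z - l = w - l"
      using zw(3) by (metis div_mult_mod_eq)
    then show "z = w" by simp
  qed
  moreover have "?q ` F \<subseteq> {0..<k}"
  proof clarify
    fix z assume "z \<in> F"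
    then have z: "0 \<le> z - l" "z - l < k * n"
      using F by (auto simp: algebra_simps)
    have "?q z * n + (z - l) mod n = z - l" "0 \<le> (z - l) mod n"
      using \<open>n > 0\<close> by simp_all
    then have "?q z * n < k * n"
      using z(2) by linarith
    then show "?q z \<in> {0..<k}"
      using \<open>n > 0\<close> z(1) by (simp add: pos_imp_zdiv_nonneg_iff)
  qed
  ultimately have "card F \<le> card {0..<k}"
    by (metis card_inj_on_le finite_atLeastLessThan_int)
  then show ?thesis
    using \<open>k \<ge> 0\<close> by simp
qed

text \<open>The planar counting bound. With \<open>M = n k\<close> the largest cross product, attained at \<open>(a, k b')\<close> for a
  primitive \<open>b'\<close>, one of \<open>x\<close> and \<open>- x\<close> for each \<open>x\<close> in \<open>C\<close> lies on one of the \<open>n + 1\<close> lattice lines \<open>cross x b' = j\<close> with \<open>0 \<le> j \<le> n\<close>. On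
  each of them \<open>cross a\<close> is injective with values in one residue class modulo \<open>n\<close>, so a window of
  length \<open>n K\<close> for these values leaves room for \<open>K\<close> points. The windows have length
  \<^item> \<open>n k\<close> for \<open>j = 0\<close>, as only one of \<open>x\<close> and \<open>- x\<close> counts;
  \<^item> \<open>2 n k\<close> for \<open>0 < j < n\<close>, where the end \<open>cross a x = M\<close> of the symmetric interval is excluded by the
    choice of \<open>b\<close>;
  \<^item> \<open>n (k + 1)\<close> for \<open>j = n\<close>, as two points there have a cross product equal to the difference of
    their values.

  In total this gives \<open>k + 2 k (n - 1) + (k + 1) = 2 M + 1\<close>.\<close>

lemma card_no_opposite_le_pairwise_cross:
  fixes C P :: "(int \<times> int) set"
  assumes fin: "finite C" and sym: "\<And>x. x \<in> C \<Longrightarrow> - x \<in> C"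
    and bound: "\<And>x y. x \<in> C \<Longrightarrow> y \<in> C \<Longrightarrow> cross x y \<le> D"
    and span: "\<exists>x\<in>C. \<exists>y\<in>C. cross x y \<noteq> 0"
    and P: "P \<subseteq> C" "0 \<notin> P" "\<And>x. x \<in> P \<Longrightarrow> - x \<notin> P"
  shows "int (card P) \<le> 2 * D + 1"
proof -
  define M where "M = Max ((\<lambda>(x, y). cross x y) ` (C \<times> C))"
  have M_ge: "cross x y \<le> M" if "x \<in> C" "y \<in> C" for x y
    unfolding M_def using fin that by (intro Max_ge) (auto intro!: image_eqI[of _ _ "(x, y)"])
  have "M \<in> (\<lambda>(x, y). cross x y) ` (C \<times> C)"
    unfolding M_def using fin span by (intro Max_in) auto
  then obtain a b0 where ab0: "a \<in> C" "b0 \<in> C" "cross a b0 = M"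
    by auto
  have "M \<le> D"
    using bound[OF ab0(1,2)] ab0(3) by simp
  have "M > 0"
  proof -
    obtain x y where xy: "x \<in> C" "y \<in> C" "cross x y \<noteq> 0"
      using span by blast
    then have "0 < cross x y \<or> 0 < cross x (- y)" by auto
    then show ?thesis
      using M_ge[OF xy(1,2)] M_ge[OF xy(1) sym[OF xy(2)]] by auto
  qed
  have M_ge_abs: "\<bar>cross x y\<bar> \<le> M" if "x \<in> C" "y \<in> C" for x y
    using M_ge[OF that] M_ge[OF sym[OF that(1)] that(2)] by simp
  \<comment> \<open>Several points of \<open>C\<close> may reach \<open>M\<close> together with \<open>a\<close>. They lie on a line parallel to \<open>a\<close>, and \<open>b\<close> is
    taken at its far end in direction \<open>a\<close>; without this choice the lines strictly between \<open>j = 0\<close> and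
    \<open>j = n\<close> could contain \<open>2 k + 1\<close> points each.\<close>
  define E where "E = {x \<in> C. cross a x = M}"
  have "finite E" "b0 \<in> E"
    using fin ab0 by (auto simp: E_def)
  then have "Max ((\<lambda>x. cross x b0) ` E) \<in> (\<lambda>x. cross x b0) ` E"
    by (intro Max_in) auto
  then obtain b where b: "b \<in> E" "cross b b0 = Max ((\<lambda>x. cross x b0) ` E)"
    by auto
  then have b_max: "cross x b0 \<le> cross b b0" if "x \<in> E" for x
    using that \<open>finite E\<close> by simp
  have extreme: "cross x b \<le> 0" if "x \<in> C" "cross a x = M" for x
  proof -
    have "cross a b = M" using b by (simp add: E_def)
    have "M * cross x b = M * (cross b0 b - cross b0 x)"
      using cross_pluecker[of a b0 x b] ab0 that \<open>cross a b = M\<close> by (simp add: algebra_simps)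
    then have "cross x b = cross x b0 - cross b b0"
      using \<open>M > 0\<close> cross_swap[of b0] by auto
    then show ?thesis
      using b_max[of x] that by (simp add: E_def)
  qed
  define k where "k = gcd (fst b) (snd b)"
  define b' where "b' = (fst b div k, snd b div k)"
  have bC: "b \<in> C" "cross a b = M"
    using b by (auto simp: E_def)
  then have "b \<noteq> 0"
    using \<open>M > 0\<close> by (auto simp: cross_def)
  then have k: "k > 0"
    by (auto simp: k_def prod_eq_iff)
  have coprime: "coprime (fst b') (snd b')"
    using k by (auto simp: b'_def k_def intro: div_gcd_coprime)
  have b_eq: "fst b = k * fst b'" "snd b = k * snd b'"
    by (simp_all add: b'_def k_def)
  define n where "n = cross a b'"
  have cross_b: "cross x b = k * cross x b'" for x
    by (simp add: cross_def b_eq algebra_simps)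
  have M_eq: "M = n * k"
    using bC(2) cross_b[of a] unfolding n_def by (simp add: mult.commute)
  have n: "n > 0"
    using M_eq \<open>M > 0\<close> k by (simp add: zero_less_mult_iff)
  have inj: "inj_on (cross a) {x \<in> C. cross x b' = j}" for j
  proof (rule inj_onI)
    fix x y assume "x \<in> {x \<in> C. cross x b' = j}" "y \<in> {x \<in> C. cross x b' = j}" "cross a x = cross a y"
    then show "x = y"
      using n by (intro eq_if_cross_eq[of a b']) (simp_all add: n_def)
  qed
  have fibre: "int (card S) \<le> K"
    if "S \<subseteq> {x \<in> C. cross x b' = j}" "K \<ge> 0"
      "\<And>x. x \<in> S \<Longrightarrow> l \<le> cross a x \<and> cross a x < l + n * K" for S K l j
  proof -
    have "card S = card (cross a ` S)"
      using inj_on_subset[OF inj that(1)] by (simp add: card_image)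
    moreover have "int (card (cross a ` S)) \<le> K"
      using n that(2)
    proof (rule card_congruent_le[where l = l])
      show "cross a ` S \<subseteq> {l..<l + n * K}"
        using that(3) by auto
      show "n dvd z - w" if "z \<in> cross a ` S" "w \<in> cross a ` S" for z w
        using that \<open>S \<subseteq> _\<close> coprime unfolding n_def
        by (auto intro!: cross_dvd_if_coprime)
    qed
    ultimately show ?thesis by simp
  qed
  \<comment> \<open>The points on the line \<open>j = 0\<close> that represent their antipodal pair, and the line \<open>j\<close>\<close>
  define Q0 where "Q0 = {x \<in> C. cross x b' = 0 \<and> cross a x > 0}"
  define Q where "Q = (\<lambda>j. {x \<in> C. cross x b' = j})"
  have f_le: "cross x b' \<le> n" if "x \<in> C" for x
    using M_ge[OF that bC(1)] k by (simp add: M_eq cross_b mult.commute)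
  have Q0: "int (card Q0) \<le> k"
  proof (rule fibre[where l = 1 and j = 0])
    fix x assume "x \<in> Q0"
    then show "1 \<le> cross a x \<and> cross a x < 1 + n * k"
      using M_ge[OF ab0(1), of x] by (simp add: Q0_def M_eq)
  qed (use k in \<open>auto simp: Q0_def\<close>)
  have Q: "int (card (Q j)) \<le> 2 * k" if "j > 0" for j
  proof (rule fibre[where l = "- (n * k)" and j = j])
    fix x assume x: "x \<in> Q j"
    have "cross a x \<noteq> M"
    proof
      assume "cross a x = M"
      then have "k * j \<le> 0"
        using extreme[of x] x by (simp add: Q_def cross_b)
      then show False
        using k that by (simp add: mult_le_0_iff)
    qed
    then show "- (n * k) \<le> cross a x \<and> cross a x < - (n * k) + n * (2 * k)"
      using M_ge_abs[OF ab0(1), of x] x by (auto simp: Q_def M_eq algebra_simps)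
  qed (use k in \<open>auto simp: Q_def\<close>)
  have Qn: "int (card (Q n)) \<le> k + 1"
  proof -
    have "a \<in> Q n"
      using ab0(1) by (simp add: Q_def n_def)
    moreover have "finite (Q n)"
      using fin by (simp add: Q_def)
    ultimately have "finite (cross a ` Q n)" "cross a ` Q n \<noteq> {}"
      by auto
    then have "Min (cross a ` Q n) \<in> cross a ` Q n"
      by (rule Min_in)
    then obtain y where y: "y \<in> Q n" "Min (cross a ` Q n) = cross a y"
      by (rule imageE)
    then have y_min: "cross a y \<le> cross a x" if "x \<in> Q n" for x
      using Min_le[OF \<open>finite (cross a ` Q n)\<close>, of "cross a x"] that y(2) by simp
    \<comment> \<open>As \<open>x\<close> and \<open>y\<close> have the same first coordinate as \<open>a\<close> in the basis \<open>a, b'\<close>, their cross product is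
      the difference of their values, and \<open>M = n k\<close> bounds the spread of all values on the line.\<close>
    show ?thesis
    proof (rule fibre[where l = "cross a y" and j = n])
      fix x assume x: "x \<in> Q n"
      have "n * cross y x = n * (cross a x - cross a y)"
        using cross_pluecker[of a b' y x] cross_swap[of b' x] cross_swap[of b' y] x y
        by (simp add: Q_def n_def algebra_simps)
      then have "cross a x - cross a y \<le> n * k"
        using M_ge[of y x] n x y by (simp add: Q_def M_eq)
      then show "cross a y \<le> cross a x \<and> cross a x < cross a y + n * (k + 1)"
        using y_min[OF x] n by (simp add: algebra_simps)
    qed (use k in \<open>auto simp: Q_def\<close>)
  qed
  define H where "H = Q0 \<union> (\<Union>j\<in>{1..<n}. Q j) \<union> Q n"
  have "finite H"
    by (rule finite_subset[OF _ fin]) (auto simp: H_def Q0_def Q_def)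
  have H: "x \<in> H \<or> - x \<in> H" if "x \<in> C" "x \<noteq> 0" for x
  proof -
    have *: "y \<in> H" if "y \<in> C" "cross y b' > 0 \<or> cross y b' = 0 \<and> cross a y > 0" for y
      using that f_le[of y] by (fastforce simp: H_def Q_def Q0_def)
    have "cross x b' \<noteq> 0 \<or> cross a x \<noteq> 0"
      using eq_if_cross_eq[of a b' x 0] n \<open>x \<noteq> 0\<close> by (auto simp: n_def cross_def)
    moreover have "cross (- x) b' = - cross x b'" "cross a (- x) = - cross a x"
      by simp_all
    ultimately show ?thesis
      using *[OF that(1)] *[OF sym[OF that(1)]] by linarith
  qed
  \<comment> \<open>Moving every point of \<open>P\<close> into the half \<open>H\<close> by a sign change merges no two of them.\<close>
  have "inj_on (\<lambda>x. if x \<in> H then x else - x) P"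
    using P(3) by (auto intro!: inj_onI split: if_splits)
  moreover have "(\<lambda>x. if x \<in> H then x else - x) ` P \<subseteq> H"
  proof (rule image_subsetI)
    fix x assume "x \<in> P"
    then have "x \<in> C" "x \<noteq> 0"
      using P(1,2) by auto
    then show "(if x \<in> H then x else - x) \<in> H"
      using H[of x] by auto
  qed
  ultimately have "card P \<le> card H"
    using \<open>finite H\<close> by (rule card_inj_on_le)
  also have "card H \<le> card (Q0 \<union> (\<Union>j\<in>{1..<n}. Q j)) + card (Q n)"
    unfolding H_def by (rule card_Un_le)
  also have "card (Q0 \<union> (\<Union>j\<in>{1..<n}. Q j)) \<le> card Q0 + card (\<Union>j\<in>{1..<n}. Q j)"
    by (rule card_Un_le)
  finally have "int (card P) \<le> int (card Q0) + int (card (\<Union>j\<in>{1..<n}. Q j)) + int (card (Q n))"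
    by simp
  moreover have "int (card (\<Union>j\<in>{1..<n}. Q j)) \<le> (n - 1) * (2 * k)"
  proof -
    have "int (card (\<Union>j\<in>{1..<n}. Q j)) \<le> (\<Sum>j\<in>{1..<n}. int (card (Q j)))"
      using card_UN_le[of "{1..<n}" Q] by (simp flip: of_nat_sum)
    also have "\<dots> \<le> (\<Sum>j\<in>{1..<n}. 2 * k)"
      using Q by (intro sum_mono) simp
    also have "\<dots> = (n - 1) * (2 * k)"
      using n by simp
    finally show ?thesis .
  qed
  ultimately have "int (card P) \<le> k + (n - 1) * (2 * k) + (k + 1)"
    using Q0 Qn by linarith
  also have "\<dots> = 2 * M + 1"
    by (simp add: M_eq algebra_simps)
  finally show ?thesis
    using \<open>M \<le> D\<close> by linarith
qed

section \<open>Full row rank and minors\<close>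

lemma (in vec_space) ex_lin_indpt_cols_card_rank:
  assumes A: "A \<in> carrier_mat n nc"
  shows "\<exists>S. S \<subseteq> set (cols A) \<and> lin_indpt S \<and> card S = rank A"
proof -
  have "lin_indpt {}"
    using finite_lin_indpt2[of "{}"] by simp
  then obtain S where S: "maximal S (\<lambda>T. T \<subseteq> set (cols A) \<and> lin_indpt T)"
    using maximal_exists_superset[of "set (cols A)" "\<lambda>T. T \<subseteq> set (cols A) \<and> lin_indpt T" "{}"]
    by blast
  then have "S \<subseteq> set (cols A)" "lin_indpt S"
    by (simp_all add: maximal_def)
  moreover have "rank A = card S"
    using rank_card_indpt[OF A S] .
  ultimately show ?thesis
    by auto
qed

lemma (in vec_space) rank_le_dim_row:
  assumes A: "A \<in> carrier_mat n nc"
  shows "rank A \<le> n"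
proof -
  obtain S where S: "S \<subseteq> set (cols A)" "lin_indpt S" "card S = rank A"
    using ex_lin_indpt_cols_card_rank[OF A] by blast
  then have "S \<subseteq> carrier_vec n"
    using A cols_dim by blast
  then show ?thesis
    using li_le_dim(2)[of S] S dim_is_n by simp
qed

text \<open>A maximal independent set of columns of a matrix of full row rank is a basis, hence the
  column set of an invertible matrix. This turns the rank hypothesis into a nonzero minor.\<close>

lemma (in vec_space) full_rank_obtains_nonzero_det:
  assumes A: "A \<in> carrier_mat n nc" and full: "rank A = n"
  obtains us where "length us = n" "set us \<subseteq> set (cols A)" "det (mat_of_cols n us) \<noteq> 0"
proof -
  obtain S where S: "S \<subseteq> set (cols A)" "lin_indpt S" "card S = n"
    using ex_lin_indpt_cols_card_rank[OF A] full by auto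
  then obtain us where us: "set us = S" "distinct us"
    using finite_distinct_list[of S] finite_subset by blast
  then have len: "length us = n"
    using S(3) distinct_card by fastforce
  have "set us \<subseteq> carrier_vec n"
    using A S(1) us(1) cols_dim by blast
  then have "cols (mat_of_cols n us) = us"
    by simp
  then have "rank (mat_of_cols n us) = n"
    using lin_indpt_full_rank[of "mat_of_cols n us" n] us S(2) len by (metis mat_of_cols_carrier(1))
  then have "det (mat_of_cols n us) \<noteq> 0"
    using det_rank_iff[of "mat_of_cols n us"] len by (metis mat_of_cols_carrier(1))
  then show thesis
    using that us(1) S(1) len by blast
qed

lemma det_2x2:
  fixes A :: "'a :: comm_ring_1 mat"
  assumes "A \<in> carrier_mat 2 2"
  shows "det A = A $$ (0, 0) * A $$ (1, 1) - A $$ (0, 1) * A $$ (1, 0)"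
proof -
  have perms: "{p. p permutes {0..<2::nat}} = {id, Transposition.transpose 0 1}"
    by (auto simp: permutes_doubleton_iff numeral_2_eq_2 atLeastLessThanSuc insert_commute)
  have "(id :: nat \<Rightarrow> nat) \<noteq> Transposition.transpose 0 1"
    by (metis id_apply transpose_apply_first zero_neq_one)
  then show ?thesis
    unfolding det_def'[OF assms] perms
    by (simp add: numeral_2_eq_2 sign_swap_id)
qed

lemma pick_singleton: "pick {i} 0 = i"
  by (simp add: Least_equality)

lemma pick_doubleton:
  assumes "i < j"
  shows "pick {i, j} 0 = i" "pick {i, j} 1 = j"
proof -
  have "{a \<in> {i, j}. a < i} = {}" "{a \<in> {i, j}. a < j} = {i}"
    using assms by auto
  then have "card {a \<in> {i, j}. a < i} = 0" "card {a \<in> {i, j}. a < j} = 1"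
    by (simp_all only: card.empty card_1_singleton_iff One_nat_def) blast
  then show "pick {i, j} 0 = i" "pick {i, j} 1 = j"
    by (metis insertI1 insertI2 pick_card_in_set)+
qed

lemma pick_lessThan:
  assumes "k < n"
  shows "pick {..<n} k = k"
proof -
  have "{a \<in> {..<n}. a < k} = {..<k}"
    using assms by auto
  then show ?thesis
    using assms by (metis card_lessThan lessThan_iff pick_card_in_set)
qed

lemma det_submatrix_singleton:
  fixes A :: "'a :: comm_ring_1 mat"
  assumes "dim_row A = 1" "j < dim_col A"
  shows "det (submatrix A {..<1} {j}) = A $$ (0, j)"
proof -
  have "{r. r < dim_row A \<and> r \<in> {..<1}} = {0}" "{c. c < dim_col A \<and> c \<in> {j}} = {j}"
    using assms by auto
  then have "submatrix A {..<1} {j} = mat 1 1 (\<lambda>_. A $$ (0, j))"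
    unfolding submatrix_def by (intro eq_matI) (simp_all add: pick_singleton pick_lessThan del: pick.simps)
  then show ?thesis
    by (simp add: det_single)
qed

lemma det_submatrix_doubleton:
  fixes A :: "'a :: comm_ring_1 mat"
  assumes "dim_row A = 2" "i < j" "j < dim_col A"
  shows "det (submatrix A {..<2} {i, j}) = A $$ (0, i) * A $$ (1, j) - A $$ (0, j) * A $$ (1, i)"
proof -
  have sets: "{r. r < dim_row A \<and> r \<in> {..<2}} = {0, 1}" "{c. c < dim_col A \<and> c \<in> {i, j}} = {i, j}"
    using assms by auto
  have pick: "pick {..<2} 0 = 0" "pick {..<2} (Suc 0) = 1" "pick {i, j} 0 = i" "pick {i, j} (Suc 0) = j"
    using pick_doubleton[OF assms(2)] pick_lessThan[of 0 2] pick_lessThan[of 1 2]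
    by (simp_all del: pick.simps)
  have "card {i, j} = 2"
    using assms(2) by simp
  then have "submatrix A {..<2} {i, j} = mat 2 2 (\<lambda>(r, c). A $$ (r, if c = 0 then i else j))"
    unfolding submatrix_def sets
    by (intro eq_matI) (auto simp: less_2_cases_iff pick simp del: pick.simps)
  then show ?thesis
    by (simp add: det_2x2)
qed

lemma finite_minors:
  "finite {\<bar>det (submatrix A {..<dim_row A} J)\<bar> | J. J \<subseteq> {..<dim_col A} \<and> card J = dim_row A}"
  by (rule finite_image_set) simp

lemma minor_le_max_minor:
  assumes "J \<subseteq> {..<dim_col A}" "card J = dim_row A"
  shows "\<bar>det (submatrix A {..<dim_row A} J)\<bar> \<le> max_minor A"
  unfolding max_minor_def
  by (rule Max_ge[OF finite_minors], rule CollectI, rule exI[of _ J], rule conjI[OF refl], rule conjI)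
    (fact assms)+

text \<open>One nonzero minor already forces full row rank: it stays nonzero after the embedding into the
  reals, and the rank dominates the order of every nonvanishing minor.\<close>

lemma modularI:
  assumes J: "J \<subseteq> {..<dim_col A}" "card J = dim_row A" "det (submatrix A {..<dim_row A} J) \<noteq> 0"
    and bound: "\<And>J. J \<subseteq> {..<dim_col A} \<Longrightarrow> card J = dim_row A \<Longrightarrow>
      \<bar>det (submatrix A {..<dim_row A} J)\<bar> \<le> D"
  shows "modular D A"
proof -
  let ?B = "map_mat real_of_int A"
  have B: "?B \<in> carrier_mat (dim_row A) (dim_col A)"
    by (rule carrier_matI) simp_all
  have "submatrix ?B {..<dim_row A} J = map_mat real_of_int (submatrix A {..<dim_row A} J)"
    by (rule eq_matI) (auto simp: submatrix_def pick_lessThan pick_le simp del: pick.simps)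
  then have "det (submatrix ?B {..<dim_row A} J) \<noteq> 0"
    using J(3) by simp
  then have "card {j. j < dim_col A \<and> j \<in> J} \<le> vec_space.rank (dim_row A) ?B"
    by (rule vec_space.rank_gt_minor[OF B])
  moreover have "{j. j < dim_col A \<and> j \<in> J} = J"
    using J(1) by auto
  ultimately have "full_row_rank A"
    using J(2) vec_space.rank_le_dim_row[OF B] by (simp add: full_row_rank_def)
  moreover have "max_minor A \<le> D"
    unfolding max_minor_def
  proof (rule Max.boundedI[OF finite_minors])
    show "{\<bar>det (submatrix A {..<dim_row A} J)\<bar> | J. J \<subseteq> {..<dim_col A} \<and> card J = dim_row A} \<noteq> {}"
      using J(1,2) by auto
    fix d
    assume "d \<in> {\<bar>det (submatrix A {..<dim_row A} J)\<bar> | J. J \<subseteq> {..<dim_col A} \<and> card J = dim_row A}"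
    then obtain K where "d = \<bar>det (submatrix A {..<dim_row A} K)\<bar>" "K \<subseteq> {..<dim_col A}" "card K = dim_row A"
      unfolding mem_Collect_eq by (elim exE conjE)
    then show "d \<le> D"
      using bound[of K] by simp
  qed
  ultimately show ?thesis
    by (simp add: modular_def)
qed

section \<open>Counting differing columns\<close>

text \<open>A repeated vector would form a pair with itself, so a multiset with differing columns is a set.\<close>

lemma differing_columnsD:
  assumes "differing_columns X"
  shows "X = mset_set (set_mset X)"
    and "a \<in># X \<Longrightarrow> b \<in># X \<Longrightarrow> a \<noteq> b \<Longrightarrow> a \<noteq> - b"
    and "a \<in># X \<Longrightarrow> a \<noteq> 0\<^sub>v (dim_vec a)"
proof -
  have differ: "differ a b" if "{#a, b#} \<subseteq># X" for a b
    using assms that by (auto simp: differing_columns_def)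
  have "count X a = count (mset_set (set_mset X)) a" for a
  proof (cases "a \<in># X")
    case True
    have "\<not> {#a, a#} \<subseteq># X"
      using differ[of a a] by (auto simp: differ_def)
    then have "\<not> 2 \<le> count X a"
      by (auto simp: subseteq_mset_def split: if_splits)
    then show ?thesis
      using True by (simp add: Suc_le_eq flip: count_greater_zero_iff)
  qed (simp add: not_in_iff)
  then show "X = mset_set (set_mset X)"
    by (rule multiset_eqI)
  show "a \<noteq> - b" if "a \<in># X" "b \<in># X" "a \<noteq> b"
  proof -
    have "{#a, b#} \<subseteq># X"
      using that by (auto simp: subseteq_mset_def Suc_le_eq)
    then show ?thesis
      using differ by (simp add: differ_def)
  qed
  show "a \<noteq> 0\<^sub>v (dim_vec a)" if "a \<in># X"
    using assms that by (simp add: differing_columns_def)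
qed

lemma differing_columnsI:
  assumes "distinct xs"
    and "\<And>a b. a \<in> set xs \<Longrightarrow> b \<in> set xs \<Longrightarrow> a \<noteq> b \<Longrightarrow> a \<noteq> - b"
    and "\<And>a. a \<in> set xs \<Longrightarrow> a \<noteq> 0\<^sub>v (dim_vec a)"
  shows "differing_columns (mset xs)"
proof -
  have "differ a b" if ab: "{#a, b#} \<subseteq># mset xs" for a b
  proof -
    have "a \<in> set xs" "b \<in> set xs"
      using mset_subset_eqD[OF ab] by auto
    moreover have "a \<noteq> b"
    proof
      assume "a = b"
      then have "2 \<le> count (mset xs) a"
        using mset_subset_eq_count[OF ab, of a] by simp
      then show False
        using \<open>distinct xs\<close> by (simp add: distinct_count_atmost_1 split: if_splits)
    qed
    ultimately show ?thesis
      using assms(2) by (simp add: differ_def)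
  qed
  then show ?thesis
    using assms(3) by (simp add: differing_columns_def)
qed

lemma finite_differing_sizes: "finite {size X | X. X \<subseteq># M \<and> differing_columns X}"
  by (rule finite_subset[of _ "{..size M}"]) (auto dest: size_mset_mono)

lemma num_differing_columns_le:
  assumes "\<And>X. X \<subseteq># mset (cols A) \<Longrightarrow> differing_columns X \<Longrightarrow> size X \<le> N"
  shows "num_differing_columns A \<le> N"
proof -
  have "differing_columns {#}"
    by (simp add: differing_columns_def)
  then have "{size X | X. X \<subseteq># mset (cols A) \<and> differing_columns X} \<noteq> {}"
    by (metis (mono_tags, lifting) empty_iff empty_le mem_Collect_eq)
  then show ?thesis
    unfolding num_differing_columns_def using assms finite_differing_sizes by (subst Max_le_iff) auto
qed

lemma num_differing_columns_eq_dim_col: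
  assumes "differing_columns (mset (cols A))"
  shows "num_differing_columns A = dim_col A"
proof (rule antisym)
  show "num_differing_columns A \<le> dim_col A"
    by (rule num_differing_columns_le) (metis cols_length size_mset size_mset_mono)
  have "size (mset (cols A)) \<le> num_differing_columns A"
    unfolding num_differing_columns_def
    by (rule Max_ge[OF finite_differing_sizes], rule CollectI, rule exI[of _ "mset (cols A)"]) (simp add: assms)
  then show "dim_col A \<le> num_differing_columns A" by simp
qed

text \<open>The upper bound is asked for each multiset \<open>X\<close> of columns, but under the modularity of all of \<open>A\<close>:
  the rank hypothesis need not pass to \<open>X\<close>.\<close>

lemma max_num_differing_columns_eqI:
  assumes upper: "\<And>A X. dim_row A = m \<Longrightarrow> modular D A \<Longrightarrow> X \<subseteq># mset (cols A) \<Longrightarrow>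
      differing_columns X \<Longrightarrow> size X \<le> N"
    and witness: "dim_row W = m" "modular D W" "differing_columns (mset (cols W))" "dim_col W = N"
  shows "max_num_differing_columns D m = N"
proof -
  let ?V = "{num_differing_columns A | A. dim_row A = m \<and> modular D A}"
  have le: "v \<le> N" if "v \<in> ?V" for v
    using that num_differing_columns_le upper by blast
  moreover have "N = num_differing_columns W"
    using num_differing_columns_eq_dim_col[OF witness(3)] witness(4) by simp
  then have "N \<in> ?V"
    using witness(1,2) by blast
  moreover have "finite ?V"
    using le by (intro finite_subset[of ?V "{..N}"]) auto
  ultimately show ?thesis
    unfolding max_num_differing_columns_def by (intro Max_eqI) auto
qed

lemma in_set_colsE:
  assumes "u \<in> set (cols A)"
  obtains j where "j < dim_col A" "u = col A j"
  using assms by (metis cols_length cols_nth in_set_conv_nth)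

section \<open>One row\<close>

text \<open>The minors are the entries, so the absolute values of differing columns are distinct numbers
  between \<open>1\<close> and \<open>D\<close>.\<close>

lemma one_row_upper:
  assumes A: "dim_row A = 1" "modular D A"
    and X: "X \<subseteq># mset (cols A)" "differing_columns X"
  shows "size X \<le> nat D"
proof -
  have cols: "dim_vec v = 1 \<and> \<bar>v $ 0\<bar> \<le> D" if "v \<in># X" for v
  proof -
    have "v \<in> set (cols A)"
      using that X(1) mset_subset_eqD by fastforce
    then obtain j where j: "j < dim_col A" "v = col A j"
      by (rule in_set_colsE)
    then have "\<bar>A $$ (0, j)\<bar> \<le> max_minor A"
      using minor_le_max_minor[of "{j}" A] det_submatrix_singleton[of A j] A(1) by simp
    then show ?thesis
      using j A by (simp add: modular_def)
  qed
  have inj: "inj_on (\<lambda>v. \<bar>v $ 0\<bar>) (set_mset X)"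
  proof (rule inj_onI)
    fix v w assume vw: "v \<in># X" "w \<in># X" "\<bar>v $ 0\<bar> = \<bar>w $ 0\<bar>"
    then have "v = w \<or> v = - w"
      using cols[of v] cols[of w] by (auto simp: vec_eq_iff abs_eq_iff)
    then show "v = w"
      using differing_columnsD(2)[OF X(2)] vw by blast
  qed
  have "(\<lambda>v. \<bar>v $ 0\<bar>) ` set_mset X \<subseteq> {1..D}"
  proof clarify
    fix v assume v: "v \<in># X"
    have "v $ 0 \<noteq> 0"
      using differing_columnsD(3)[OF X(2) v] cols[OF v] by (auto simp: vec_eq_iff)
    then show "\<bar>v $ 0\<bar> \<in> {1..D}"
      using cols[OF v] by auto
  qed
  then have "card (set_mset X) \<le> card {1..D}"
    using inj by (metis card_inj_on_le finite_atLeastAtMost_int)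
  then show ?thesis
    using differing_columnsD(1)[OF X(2)] by (metis card_atLeastAtMost_int diff_add_cancel size_mset_set)
qed

lemma one_row_witness:
  assumes "D \<ge> 1"
  defines "W \<equiv> mat 1 (nat D) (\<lambda>(i, j). int j + 1)"
  shows "modular D W" "differing_columns (mset (cols W))"
proof -
  have dims: "dim_row W = 1" "dim_col W = nat D"
    by (simp_all add: W_def)
  have minor: "det (submatrix W {..<1} {j}) = int j + 1" if "j < nat D" for j
    using that det_submatrix_singleton[of W j] by (simp add: W_def)
  show "modular D W"
  proof (rule modularI[of "{0}"])
    fix J assume J: "J \<subseteq> {..<dim_col W}" "card J = dim_row W"
    then obtain j where "J = {j}"
      by (auto simp: dims card_1_singleton_iff)
    then show "\<bar>det (submatrix W {..<dim_row W} J)\<bar> \<le> D"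
      using J minor[of j] by (simp add: dims)
  qed (use assms(1) minor[of 0] in \<open>simp_all add: dims\<close>)
  have col: "col W j $ 0 = int j + 1" "dim_vec (col W j) = 1" if "j < nat D" for j
    using that by (simp_all add: W_def)
  have pos: "a $ 0 > 0" "dim_vec a = 1" if a: "a \<in> set (cols W)" for a
  proof -
    obtain j where "j < dim_col W" "a = col W j"
      using a by (rule in_set_colsE)
    then show "a $ 0 > 0" "dim_vec a = 1"
      using col[of j] by (simp_all add: dims)
  qed
  show "differing_columns (mset (cols W))"
  proof (rule differing_columnsI)
    show "distinct (cols W)"
    proof (unfold distinct_conv_nth, intro allI impI)
      fix i j assume ij: "i < length (cols W)" "j < length (cols W)" "i \<noteq> j"
      then have "col W i $ 0 \<noteq> col W j $ 0"
        using col(1)[of i] col(1)[of j] by (simp add: dims)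
      then show "cols W ! i \<noteq> cols W ! j"
        using ij by auto
    qed
    show "a \<noteq> - b" if "a \<in> set (cols W)" "b \<in> set (cols W)" for a b
      using pos[OF that(1)] pos[OF that(2)] by auto
    show "a \<noteq> 0\<^sub>v (dim_vec a)" if "a \<in> set (cols W)" for a
      using pos[OF that] index_zero_vec(1)[of 0 1] by force
  qed
qed

section \<open>Two rows\<close>

abbreviation coords :: "int vec \<Rightarrow> int \<times> int" where
  "coords v \<equiv> (v $ 0, v $ 1)"

lemma uminus_mem_symmetrization:
  fixes S :: "'a :: group_add set"
  assumes "x \<in> S \<union> uminus ` S"
  shows "- x \<in> S \<union> uminus ` S"
  using assms by auto

text \<open>The planar bound is applied to all columns of \<open>A\<close> and their negatives, and not just to \<open>X\<close>:
  the columns in \<open>X\<close> may all lie on one line, whereas \<open>A\<close> has full rank.\<close>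

lemma two_rows_upper:
  assumes A: "dim_row A = 2" "modular D A"
    and X: "X \<subseteq># mset (cols A)" "differing_columns X"
  shows "size X \<le> nat (2 * D + 1)"
proof -
  let ?S = "coords ` set (cols A)"
  let ?C = "?S \<union> uminus ` ?S"
  have dim: "dim_vec u = 2" if "u \<in> set (cols A)" for u
    using that A(1) by (auto elim: in_set_colsE)
  have minor: "cross (coords (col A i)) (coords (col A j)) = det (submatrix A {..<2} {i, j})"
    if "i < j" "j < dim_col A" for i j
    using that det_submatrix_doubleton[OF A(1) that] A(1) by (simp add: cross_def)
  have minor_le: "\<bar>cross (coords (col A i)) (coords (col A j))\<bar> \<le> D"
    if "i < j" "j < dim_col A" for i j
    using minor[OF that] minor_le_max_minor[of "{i, j}" A] that A by (simp add: modular_def)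
  have bound_col: "\<bar>cross (coords (col A i)) (coords (col A j))\<bar> \<le> D"
    if "i \<noteq> j" "i < dim_col A" "j < dim_col A" for i j
  proof (cases "i < j")
    case True
    then show ?thesis
      using minor_le that by simp
  next
    case False
    then show ?thesis
      using minor_le[of j i] that cross_swap[of "coords (col A i)"] by simp
  qed
  let ?R = "map_mat real_of_int A"
  have R: "?R \<in> carrier_mat 2 (dim_col A)"
    by (rule carrier_matI) (simp_all add: A(1))
  have "vec_space.rank 2 ?R = 2"
    using A by (simp add: modular_def full_row_rank_def)
  then obtain us where us: "length us = 2" "set us \<subseteq> set (cols ?R)" "det (mat_of_cols 2 us) \<noteq> 0"
    by (rule vec_space.full_rank_obtains_nonzero_det[OF R])
  then obtain u' v' where uv': "us = [u', v']"
    by (auto simp: numeral_2_eq_2 length_Suc_conv)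
  obtain i where i: "i < dim_col A" "u' = col (map_mat real_of_int A) i"
    using us(2) uv' by (auto elim: in_set_colsE)
  obtain j where j: "j < dim_col A" "v' = col (map_mat real_of_int A) j"
    using us(2) uv' by (auto elim: in_set_colsE)
  have "det (mat_of_cols 2 us) = of_int (cross (coords (col A i)) (coords (col A j)))"
  proof -
    have "mat_of_cols 2 us \<in> carrier_mat 2 2"
      using mat_of_cols_carrier(1)[of 2 us] us(1) by simp
    then show ?thesis
      using i j A(1) by (simp add: det_2x2 mat_of_cols_def cross_def uv')
  qed
  then have span: "cross (coords (col A i)) (coords (col A j)) \<noteq> 0"
    using us(3) by auto
  then have "i \<noteq> j"
    by auto
  then have "D \<ge> 0"
    using bound_col[of i j] i(1) j(1) by simp
  have bound: "\<bar>cross x y\<bar> \<le> D" if xy: "x \<in> ?S" "y \<in> ?S" for x y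
  proof -
    obtain u v where uv: "u \<in> set (cols A)" "x = coords u" "v \<in> set (cols A)" "y = coords v"
      using xy by blast
    obtain k where k: "k < dim_col A" "u = col A k"
      using uv(1) by (rule in_set_colsE)
    obtain l where l: "l < dim_col A" "v = col A l"
      using uv(3) by (rule in_set_colsE)
    show ?thesis
      using bound_col[of k l] k l uv \<open>D \<ge> 0\<close> by (cases "k = l") simp_all
  qed
  let ?P = "coords ` set_mset X"
  have sub: "set_mset X \<subseteq> set (cols A)"
    using X(1) set_mset_mono by fastforce
  have dimX: "dim_vec v = 2" if "v \<in># X" for v
    using that sub dim by blast
  have eq_iff: "v = w" if "v \<in># X" "w \<in># X" "coords v = coords w" for v w
    using that(3) dimX[OF that(1)] dimX[OF that(2)] by (auto simp: vec_eq_iff less_2_cases_iff)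
  have opp: "v = - w" if "v \<in># X" "w \<in># X" "coords v = - coords w" for v w
    using that(3) dimX[OF that(1)] dimX[OF that(2)] by (auto simp: vec_eq_iff less_2_cases_iff)
  have nz: "coords v \<noteq> 0" if "v \<in># X" for v
    using differing_columnsD(3)[OF X(2) that] dimX[OF that]
    by (auto simp: vec_eq_iff less_2_cases_iff zero_prod_def)
  have "int (card ?P) \<le> 2 * D + 1"
  proof (rule card_no_opposite_le_pairwise_cross[where C = ?C])
    show "cross x y \<le> D" if xy: "x \<in> ?C" "y \<in> ?C" for x y
    proof -
      obtain x' y' where x': "x' \<in> ?S" "x = x' \<or> x = - x'" and y': "y' \<in> ?S" "y = y' \<or> y = - y'"
        using xy by blast
      have "\<bar>cross x y\<bar> = \<bar>cross x' y'\<bar>"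
        using x'(2) y'(2) by (elim disjE) (simp_all del: uminus_Pair)
      then show ?thesis
        using bound[OF x'(1) y'(1)] by linarith
    qed
    have "col A i \<in> set (cols A)" "col A j \<in> set (cols A)"
      using i(1) j(1) nth_mem[of i "cols A"] nth_mem[of j "cols A"] by simp_all
    then have "coords (col A i) \<in> ?C" "coords (col A j) \<in> ?C"
      by simp_all
    then show "\<exists>x\<in>?C. \<exists>y\<in>?C. cross x y \<noteq> 0"
      using span by (intro bexI)
    show "- x \<in> ?C" if "x \<in> ?C" for x
      using that by (rule uminus_mem_symmetrization)
    show "?P \<subseteq> ?C"
      using sub by blast
    show "finite ?C"
      by simp
    show "- x \<notin> ?P" if "x \<in> ?P" for x
    proof
      assume "- x \<in> ?P"
      then obtain w where w: "w \<in># X" "- x = coords w"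
        by (elim imageE)
      obtain v where v: "v \<in># X" "x = coords v"
        using \<open>x \<in> ?P\<close> by (elim imageE)
      have "coords w = - coords v"
        using v(2) w(2) by simp
      then have "w = - v"
        by (rule opp[OF w(1) v(1)])
      then have "w = v"
        using differing_columnsD(2)[OF X(2) w(1) v(1)] by blast
      then have "coords v = - coords v"
        using \<open>coords w = - coords v\<close> by simp
      then show False
        using nz[OF v(1)] by (simp add: zero_prod_def)
    qed
    show "0 \<notin> ?P"
    proof
      assume "0 \<in> ?P"
      then obtain v where "v \<in># X" "0 = coords v"
        by (elim imageE)
      then show False
        using nz[of v] by simp
    qed
  qed
  moreover have "card ?P = card (set_mset X)"
    using eq_iff by (intro card_image inj_onI)
  moreover have "size X = card (set_mset X)"
    using differing_columnsD(1)[OF X(2)] by (metis size_mset_set)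
  ultimately show ?thesis
    by simp
qed

text \<open>The columns are \<open>(1, 0), \<dots>, (d, 0)\<close> followed by \<open>(0, 1), (1, 1), \<dots>, (d, 1)\<close>. Two columns of the
  second kind have a determinant between \<open>- d\<close> and \<open>d\<close> because their first entries lie in an interval of
  length \<open>d\<close>.\<close>

definition two_row_witness :: "nat \<Rightarrow> int mat" where
  "two_row_witness d = mat 2 (2 * d + 1) (\<lambda>(i, j).
     if i = 0 then (if j < d then int j + 1 else int j - int d) else (if j < d then 0 else 1))"

lemma two_row_witness:
  assumes "d \<ge> 1"
  shows "modular (int d) (two_row_witness d)" "differing_columns (mset (cols (two_row_witness d)))"
proof -
  let ?W = "two_row_witness d"
  have dims: "dim_row ?W = 2" "dim_col ?W = 2 * d + 1"
    by (simp_all add: two_row_witness_def)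
  have top: "?W $$ (0, j) = (if j < d then int j + 1 else int j - int d)"
    and bot: "?W $$ (Suc 0, j) = (if j < d then 0 else 1)" if "j < 2 * d + 1" for j
    using that by (simp_all add: two_row_witness_def)
  have minor: "det (submatrix ?W {..<2} {i, j}) =
      ?W $$ (0, i) * ?W $$ (1, j) - ?W $$ (0, j) * ?W $$ (1, i)"
    if "i < j" "j < 2 * d + 1" for i j
    using that dims by (intro det_submatrix_doubleton) simp_all
  show "modular (int d) ?W"
  proof (rule modularI[of "{0, d}"])
    fix J assume J: "J \<subseteq> {..<dim_col ?W}" "card J = dim_row ?W"
    then obtain i j where ij: "J = {i, j}" "i < j"
      by (metis card_2_iff dims(1) insert_commute linorder_neqE_nat)
    then show "\<bar>det (submatrix ?W {..<dim_row ?W} J)\<bar> \<le> int d"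
      using J minor[of i j] by (auto simp: dims top bot)
  qed (use assms minor[of 0 d] in \<open>auto simp: dims top bot\<close>)
  have col: "col ?W j $ 0 = ?W $$ (0, j)" "col ?W j $ Suc 0 = ?W $$ (Suc 0, j)" "dim_vec (col ?W j) = 2"
    if "j < 2 * d + 1" for j
    using that by (simp_all add: dims)
  \<comment> \<open>All columns lie in the same open half of the plane, so no two of them are opposite.\<close>
  have pos: "a $ Suc 0 > 0 \<or> a $ Suc 0 = 0 \<and> a $ 0 > 0" "dim_vec a = 2"
    if a: "a \<in> set (cols ?W)" for a
  proof -
    obtain j where "j < dim_col ?W" "a = col ?W j"
      using a by (rule in_set_colsE)
    then show "a $ Suc 0 > 0 \<or> a $ Suc 0 = 0 \<and> a $ 0 > 0" "dim_vec a = 2"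
      using col[of j] top[of j] bot[of j] by (simp_all add: dims)
  qed
  show "differing_columns (mset (cols ?W))"
  proof (rule differing_columnsI)
    show "distinct (cols ?W)"
    proof (unfold distinct_conv_nth, intro allI impI)
      fix i j assume ij: "i < length (cols ?W)" "j < length (cols ?W)" "i \<noteq> j"
      then have "?W $$ (0, i) \<noteq> ?W $$ (0, j) \<or> ?W $$ (Suc 0, i) \<noteq> ?W $$ (Suc 0, j)"
        by (auto simp: dims top bot)
      moreover have "i < 2 * d + 1" "j < 2 * d + 1"
        using ij by (simp_all add: dims)
      ultimately have "col ?W i \<noteq> col ?W j"
        using col(1,2) by metis
      then show "cols ?W ! i \<noteq> cols ?W ! j"
        using ij by simp
    qed
    show "a \<noteq> - b" if "a \<in> set (cols ?W)" "b \<in> set (cols ?W)" for a b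
      using pos[OF that(1)] pos[OF that(2)] by auto
    show "a \<noteq> 0\<^sub>v (dim_vec a)" if "a \<in> set (cols ?W)" for a
      using pos[OF that] index_zero_vec(1)[of 0 2] index_zero_vec(1)[of "Suc 0" 2] by force
  qed
qed

section \<open>The maximal number of differing columns\<close>

theorem proposition2:
  fixes m :: nat and \<Delta> :: int
  assumes "m \<in> {1, 2}" and "\<Delta> \<ge> 1"
  shows "real (max_num_differing_columns \<Delta> m) =
           1 / 2 * ((real m)^2 + real m) + real m * (real_of_int \<Delta> - 1)"
proof -
  consider "m = 1" | "m = 2"
    using assms(1) by auto
  then show ?thesis
  proof cases
    case 1
    have "max_num_differing_columns \<Delta> 1 = nat \<Delta>"
      using one_row_upper one_row_witness[OF assms(2)]
      by (intro max_num_differing_columns_eqI) auto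
    then show ?thesis
      using 1 assms(2) by simp
  next
    case 2
    have "max_num_differing_columns \<Delta> 2 = nat (2 * \<Delta> + 1)"
    proof (rule max_num_differing_columns_eqI[where W = "two_row_witness (nat \<Delta>)"])
      show "modular \<Delta> (two_row_witness (nat \<Delta>))"
        "differing_columns (mset (cols (two_row_witness (nat \<Delta>))))"
        using two_row_witness[of "nat \<Delta>"] assms(2) by simp_all
      show "dim_row (two_row_witness (nat \<Delta>)) = 2"
        "dim_col (two_row_witness (nat \<Delta>)) = nat (2 * \<Delta> + 1)"
        using assms(2) by (simp_all add: two_row_witness_def)
    qed (rule two_rows_upper)
    then show ?thesis
      using 2 assms(2) by simp
  qed
qed

end
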